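(* For any two homogeneous proper ultra-metric spaces $X,Y$ the Higson coronas $\nu X$ and $\nu Y$ are homeomorphic.
   Context: A metric space $(X,d)$ is: homogeneous if for any $x,y\in X$ there is an isometric bijection $f:X\to X$ with $f(x)=y$; proper if $X$ is unbounded but every closed ball $\{x\in X: d(x,x_0)\le r\}$ ($x_0\in X$, $r\in[0,\infty)$) is compact; an ultra-metric space if $d(x,y)\le\max\{d(x,z),d(z,y)\}$ for all $x,y,z\in X$. Higson corona (standard notion): for a proper metric space $X$, a bounded continuous function $f:X\to\mathbb C$ is a Higson function if for every $r>0$, $\sup\{|f(x)-f(y)|: y\in X,\ d(x,y)\le r\}\to 0$ as $x\to\infty$ (i.e. it is smaller than any given positive number for $x$ outside a suitable bounded set). The Higson functions form a unital $C^*$-algebra; the corresponding compactification of $X$ is the Higson compactification $hX$, and $\nu X=hX\setminus X$ is the Higson corona. *)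

theory Defs
  imports "HOL-Analysis.Analysis"
begin

context Metric_space
begin

definition mhomogeneous :: bool where
  "mhomogeneous \<longleftrightarrow>
     (\<forall>x\<in>M. \<forall>y\<in>M. \<exists>f. bij_betw f M M \<and> (\<forall>u\<in>M. \<forall>v\<in>M. d (f u) (f v) = d u v) \<and> f x = y)"

text \<open>Properness includes unboundedness.\<close>

definition mproper :: bool where
  "mproper \<longleftrightarrow>
     \<not> mbounded M \<and> (\<forall>x0\<in>M. \<forall>r\<ge>0. compactin mtopology (mcball x0 r))"

definition multrametric :: bool where
  "multrametric \<longleftrightarrow> (\<forall>x\<in>M. \<forall>y\<in>M. \<forall>z\<in>M. d x y \<le> max (d x z) (d z y))"

text \<open>The supremum below ranges over a nonempty set (it contains \<open>y = x\<close>) of reals that is bounded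
  above because \<open>f\<close> is bounded. Functions are taken to be extensional, so that each function on the
  carrier occurs exactly once.\<close>

definition higson_functions :: "('a \<Rightarrow> complex) set" where
  "higson_functions =
     {f \<in> extensional M. continuous_map mtopology euclidean f \<and> bounded (f ` M) \<and>
        (\<forall>r>0. \<forall>\<epsilon>>0. \<exists>B. mbounded B \<and>
           (\<forall>x \<in> M - B. (SUP y \<in> {y \<in> M. d x y \<le> r}. norm (f x - f y)) < \<epsilon>))}"

definition higson_eval :: "'a \<Rightarrow> ('a \<Rightarrow> complex) \<Rightarrow> complex" where
  "higson_eval x = (\<lambda>f\<in>higson_functions. f x)"

text \<open>The compactification determined by the algebra of Higson functions is realised as the closure
  of the image of the space under the evaluation map into the product of copies of the complex
  plane indexed by that algebra.\<close>

definition higson_compactification :: "(('a \<Rightarrow> complex) \<Rightarrow> complex) topology" where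
  "higson_compactification =
     subtopology (product_topology (\<lambda>_. euclidean) higson_functions)
       (product_topology (\<lambda>_. euclidean) higson_functions closure_of (higson_eval ` M))"

definition higson_corona :: "(('a \<Rightarrow> complex) \<Rightarrow> complex) topology" where
  "higson_corona =
     subtopology higson_compactification (topspace higson_compactification - higson_eval ` M)"

lemma higson_eval_in_product:
  "higson_eval ` M \<subseteq> topspace (product_topology (\<lambda>_. euclidean :: complex topology) higson_functions)"
  by (auto simp: higson_eval_def)

lemma topspace_higson_compactification:
  "topspace higson_compactification =
     product_topology (\<lambda>_. euclidean) higson_functions closure_of (higson_eval ` M)"
  unfolding higson_compactification_def
  by (simp add: topspace_subtopology closure_of_subset_topspace Int_absorb1 del: topspace_product_topology)

lemma Hausdorff_higson_compactification: "Hausdorff_space higson_compactification"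
  unfolding higson_compactification_def
  by (intro Hausdorff_space_subtopology) (simp add: Hausdorff_space_product_topology)

lemma compact_higson_compactification: "compact_space higson_compactification"
proof -
  let ?P = "product_topology (\<lambda>_. euclidean :: complex topology) higson_functions"
  let ?K = "PiE higson_functions (\<lambda>f. closure (f ` M))"
  have "compactin ?P ?K"
    by (auto simp: compactin_PiE higson_functions_def)
  moreover have "closedin ?P ?K"
    by (auto simp: closedin_product_topology)
  moreover have "higson_eval ` M \<subseteq> ?K"
    using closure_subset by (fastforce simp: higson_eval_def)
  ultimately have "compactin ?P (?P closure_of (higson_eval ` M))"
    by (meson closed_compactin closedin_closure_of closure_of_minimal)
  then show ?thesis
    unfolding higson_compactification_def by (rule compact_space_subtopology)
qed

lemma higson_eval_dense:
  "higson_compactification closure_of (higson_eval ` M) = topspace higson_compactification"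
  using closure_of_subset[OF higson_eval_in_product]
  by (simp add: topspace_higson_compactification)
     (simp add: higson_compactification_def closure_of_subtopology Int_absorb1)

lemma higson_bump:
  assumes "mproper" and U: "openin mtopology U" and a: "a \<in> U"
  obtains f where "f \<in> higson_functions" "f a = 1" "\<And>x. x \<in> M - U \<Longrightarrow> f x = 0"
proof -
  have aM: "a \<in> M" using U a openin_mtopology by blast
  obtain s where s: "s > 0" "mball a s \<subseteq> U"
    using U a openin_mtopology by blast
  define g :: "'a \<Rightarrow> real" where "g x = max 0 (1 - d a x / s)" for x
  define f :: "'a \<Rightarrow> complex" where "f = (\<lambda>x\<in>M. of_real (g x))"
  have cd: "continuous_map mtopology euclidean (d a)"
    using continuous_on_mdist[of a Self] aM by (simp add: mtopology_of_def)
  have "continuous_map mtopology euclidean (\<lambda>x. complex_of_real (g x))"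
  proof -
    have "continuous_map euclidean euclidean (\<lambda>t. complex_of_real (max 0 (1 - t / s)))"
      using s by (auto intro!: continuous_intros)
    from continuous_map_compose[OF cd this] show ?thesis by (simp add: o_def g_def)
  qed
  then have "continuous_map mtopology euclidean f"
    by (rule continuous_map_eq) (simp add: f_def)
  moreover have "bounded (f ` M)"
  proof -
    have "norm (f x) \<le> 1" if "x \<in> M" for x
      using that s by (simp add: f_def g_def)
    then show ?thesis by (auto simp: bounded_iff)
  qed
  moreover have "\<exists>B. mbounded B \<and> (\<forall>x \<in> M - B. (SUP y \<in> {y \<in> M. d x y \<le> r}. norm (f x - f y)) < e)"
    if "r > 0" "e > 0" for r e
  proof (intro exI conjI ballI)
    show "mbounded (mcball a (r + s))" by (rule mbounded_mcball)
    fix x assume x: "x \<in> M - mcball a (r + s)"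
    have z: "f y = 0" if "y \<in> M" "d a y > s" for y
      using that s by (simp add: f_def g_def divide_simps)
    have "f x - f y = 0" if y: "y \<in> M" "d x y \<le> r" for y
    proof -
      have "d a x > r + s" using x aM by auto
      moreover have "d a x \<le> d a y + d x y"
        using triangle[of a y x] aM x y commute by auto
      ultimately show ?thesis using z[of x] z[of y] x y \<open>r > 0\<close> by auto
    qed
    then have "(SUP y \<in> {y \<in> M. d x y \<le> r}. norm (f x - f y)) = (SUP y \<in> {y \<in> M. d x y \<le> r}. 0::real)"
      by (intro SUP_cong) auto
    also have "\<dots> = 0"
      using x \<open>r > 0\<close> by (intro cSUP_const) auto
    finally show "(SUP y \<in> {y \<in> M. d x y \<le> r}. norm (f x - f y)) < e" using \<open>e > 0\<close> by simp
  qed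
  ultimately have "f \<in> higson_functions"
    by (auto simp: higson_functions_def f_def)
  moreover have "f a = 1" using aM by (simp add: f_def g_def)
  moreover have "f x = 0" if "x \<in> M - U" for x
  proof -
    have "s \<le> d a x" using that s(2) aM by (meson DiffE in_mball not_le subsetD)
    then show ?thesis using that s(1) by (simp add: f_def g_def)
  qed
  ultimately show ?thesis using that by blast
qed

lemma embedding_map_higson_eval:
  assumes "mproper"
  shows "embedding_map mtopology higson_compactification higson_eval"
proof -
  let ?P = "product_topology (\<lambda>_. euclidean :: complex topology) higson_functions"
  have cont: "continuous_map mtopology ?P higson_eval"
    unfolding higson_eval_def continuous_map_componentwise
    by (auto simp: higson_functions_def)
  have inj: "inj_on higson_eval M"
  proof (rule inj_onI, rule ccontr)
    fix x y assume xy: "x \<in> M" "y \<in> M" "higson_eval x = higson_eval y" "x \<noteq> y"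
    have "closedin mtopology {y}"
      using xy Hausdorff_space_mtopology by (simp add: closedin_Hausdorff_singleton)
    then have "openin mtopology (M - {y})" "x \<in> M - {y}"
      using xy by (auto simp: closedin_def)
    from higson_bump[OF assms this] obtain f
      where f: "f \<in> higson_functions" "f x = 1" "\<And>z. z \<in> M - (M - {y}) \<Longrightarrow> f z = 0"
      by metis
    then have "f y = 0" using xy by simp
    then show False using f xy(3) by (auto simp: higson_eval_def dest!: fun_cong[where x=f])
  qed
  have "openin (subtopology ?P (higson_eval ` M)) (higson_eval ` U)" if U: "openin mtopology U" for U
  proof (subst openin_subopen, intro ballI)
    fix p assume "p \<in> higson_eval ` U"
    then obtain a where a: "a \<in> U" "p = higson_eval a" by auto
    obtain f where f: "f \<in> higson_functions" "f a = 1" "\<And>x. x \<in> M - U \<Longrightarrow> f x = 0"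
      using higson_bump[OF assms U a(1)] by metis
    have UM: "U \<subseteq> M" using U openin_mtopology by blast
    let ?V = "{q \<in> topspace ?P. q f \<in> - {0}}"
    have "openin ?P ?V"
      by (rule openin_continuous_map_preimage[OF continuous_map_product_projection[OF f(1)]])
         (simp add: open_Compl)
    then have "openin (subtopology ?P (higson_eval ` M)) (higson_eval ` M \<inter> ?V)"
      by (simp add: openin_subtopology_Int2)
    moreover have "p \<in> higson_eval ` M \<inter> ?V"
      using a UM f higson_eval_in_product by (auto simp: higson_eval_def)
    moreover have "higson_eval ` M \<inter> ?V \<subseteq> higson_eval ` U"
    proof
      fix q assume "q \<in> higson_eval ` M \<inter> ?V"
      then obtain x where x: "x \<in> M" "q = higson_eval x" "q f \<noteq> 0" by auto
      then have "f x \<noteq> 0" using f(1) by (simp add: higson_eval_def)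
      then have "x \<in> U" using f(3) x(1) by blast
      then show "q \<in> higson_eval ` U" using x(2) by blast
    qed
    ultimately show "\<exists>T. openin (subtopology ?P (higson_eval ` M)) T \<and> p \<in> T \<and> T \<subseteq> higson_eval ` U"
      by blast
  qed
  then have "embedding_map mtopology ?P higson_eval"
    unfolding embedding_map_def
    using cont inj higson_eval_in_product
    by (intro bijective_open_imp_homeomorphic_map)
       (auto simp: open_map_def continuous_map_in_subtopology Int_absorb1 simp del: topspace_product_topology)
  then show ?thesis
    unfolding higson_compactification_def
    using closure_of_subset[OF higson_eval_in_product]
    by (simp add: embedding_map_in_subtopology)
qed

end

end

theory Submission
  imports Defs
begin

text \<open>The corona depends only on the coarse geometry of a space, and up to coarse equivalence there is only
one homogeneous proper ultrametric space.

\<^bold>\<open>Coarse uniqueness.\<close> In a homogeneous proper ultrametric space the balls of a radius \<open>r > 0\<close> partition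
the space, and every ball of radius \<open>R \<ge> r\<close> consists of the same finite number of them; this number
tends to infinity with \<open>R\<close> because the space is unbounded. Given two such spaces \<open>X\<close> and \<open>Y\<close> and radii
\<open>\<rho> 0, \<rho> 1, \<dots>\<close>, with \<open>\<rho> s\<close> measured in \<open>X\<close> for even \<open>s\<close> and in \<open>Y\<close> for odd \<open>s\<close>, the aim is a relation
\<open>R \<subseteq> X \<times> Y\<close> on which lying in a common ball of level \<open>s\<close> implies lying in a common ball of level \<open>s + 1\<close>,
for all \<open>s\<close>. Such a relation, if it meets every ball of levels 0 and 1, is a coarse equivalence. It
turns the two hierarchies of balls into one tree, whose levels belong alternately to \<open>X\<close> and \<open>Y\<close>.
The number \<open>K s\<close> of grandchildren of a node of level \<open>s + 2\<close> is imposed by the spaces, whereas the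
number of its children is free. It is enough that a node of level \<open>s + 1\<close> has \<open>c s\<close> or \<open>c s + 1\<close>
children: then \<open>m\<close> nodes together can have any number of children from \<open>m * c s\<close> to \<open>m * (c s + 1)\<close>,
and if the radii grow fast enough, this range contains \<open>K s\<close> both for \<open>m = c (s + 1)\<close> and for
\<open>m = c (s + 1) + 1\<close>. So the same freedom of one unit is available on the next level, and the
construction goes on (\<open>matching_extend\<close>). Its union along an exhausting chain of balls is the wanted
relation (\<open>interleaved_subset_exists\<close>), from which
\<open>homogeneous_ultrametric_coarse_equivalence\<close> reads off maps in both directions.

\<^bold>\<open>From coarse geometry to the corona.\<close> The two maps are constant on balls of some positive radius, hence
continuous, so that composition with them takes Higson functions to Higson functions. This gives
continuous maps between the coronas. Points of the corona do not notice a change of a Higson function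
that tends to 0 at infinity, since every bounded set has a compact closure and can be removed from the
space without affecting the corona (\<open>corona_in_closure_outside_bounded\<close>). A composite of the two
maps moves points by a bounded distance, so it changes a Higson function only by a function that tends
to 0; therefore the induced maps of the coronas are inverse to each other
(\<open>higson_coronas_homeomorphic_if_coarsely_inverse\<close>).\<close>

section \<open>Interleaving two hierarchies of partitions\<close>

text \<open>The counting behind the alternating tree: the parts of a distribution into \<open>m\<close> parts of size \<open>c\<close> or
\<open>c + 1\<close> can absorb any total between the two extremes.\<close>

lemma balanced_assignment:
  fixes c :: nat
  assumes "finite A" "finite L" "card A * c \<le> card L" "card L \<le> card A * (c + 1)"
  shows "\<exists>g. g ` L \<subseteq> A \<and> (\<forall>a\<in>A. card {l \<in> L. g l = a} \<in> {c, c + 1})"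
  using assms
proof (induction A arbitrary: L rule: finite_induct)
  case empty
  then show ?case by simp
next
  case (insert a A)
  have ins: "card (insert a A) = card A + 1" using insert by simp
  define v where "v = (if card L \<le> card A * (c + 1) + c then c else c + 1)"
  have v: "v \<in> {c, c + 1}" by (simp add: v_def)
  have "v \<le> card L" "card A * c \<le> card L - v" "card L - v \<le> card A * (c + 1)"
    using insert.prems ins by (auto simp: v_def algebra_simps split: if_splits)
  then obtain V where V: "V \<subseteq> L" "card V = v"
    using obtain_subset_with_card_n by metis
  have "card (L - V) = card L - v"
    using V \<open>finite L\<close> by (simp add: card_Diff_subset finite_subset)
  then obtain g where g: "g ` (L - V) \<subseteq> A"
      "\<forall>b\<in>A. card {l \<in> L - V. g l = b} \<in> {c, c + 1}"
    using insert.IH[of "L - V"] \<open>finite L\<close> \<open>card A * c \<le> card L - v\<close>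
      \<open>card L - v \<le> card A * (c + 1)\<close> by auto
  define g' where "g' l = (if l \<in> V then a else g l)" for l
  have "{l \<in> L. g' l = a} = V"
    using V g(1) insert.hyps(2) by (auto simp: g'_def)
  moreover have "{l \<in> L. g' l = b} = {l \<in> L - V. g l = b}" if "b \<in> A" for b
    using that insert.hyps(2) by (auto simp: g'_def)
  ultimately have "\<forall>b\<in>insert a A. card {l \<in> L. g' l = b} \<in> {c, c + 1}"
    using v V(2) g(2) by auto
  moreover have "g' ` L \<subseteq> insert a A"
    using g(1) by (auto simp: g'_def)
  ultimately show ?case by blast
qed

text \<open>One part may even be prescribed, if the total avoids the two extremes: the remaining parts then have
room for what is left, whichever of the two sizes the prescribed part has.\<close>

lemma balanced_assignment_extending:
  fixes c :: nat
  assumes "finite A" "a0 \<in> A" "finite L" "D0 \<subseteq> L" "card D0 \<in> {c, c + 1}"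
    and "card A * c < card L" "card L < card A * (c + 1)"
  obtains g where "g ` L \<subseteq> A" "\<And>a. a \<in> A \<Longrightarrow> card {l \<in> L. g l = a} \<in> {c, c + 1}"
    "{l \<in> L. g l = a0} = D0"
proof -
  obtain m where m: "card A = Suc m" "card (A - {a0}) = m"
    using assms(1,2) by (metis card_Suc_Diff1)
  have "card (L - D0) = card L - card D0"
    using assms by (simp add: card_Diff_subset finite_subset)
  then have "card (A - {a0}) * c \<le> card (L - D0)" "card (L - D0) \<le> card (A - {a0}) * (c + 1)"
    using assms(5-7) m by auto
  then obtain g where g: "g ` (L - D0) \<subseteq> A - {a0}"
      "\<forall>a\<in>A - {a0}. card {l \<in> L - D0. g l = a} \<in> {c, c + 1}"
    using balanced_assignment[of "A - {a0}" "L - D0" c] assms(1,3) by auto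
  define g' where "g' l = (if l \<in> D0 then a0 else g l)" for l
  have D0: "{l \<in> L. g' l = a0} = D0"
    using g(1) assms(4) by (auto simp: g'_def)
  have "{l \<in> L. g' l = a} = {l \<in> L - D0. g l = a}" if "a \<in> A - {a0}" for a
    using that by (auto simp: g'_def)
  then have "card {l \<in> L. g' l = a} \<in> {c, c + 1}" if "a \<in> A" for a
    using that g(2) D0 assms(5) by (cases "a = a0") auto
  moreover have "g' ` L \<subseteq> A"
    using g(1) assms(2) by (auto simp: g'_def)
  ultimately show thesis using that D0 by blast
qed

text \<open>The tree problem without metrics. The label \<open>h s p\<close> names the ball of level \<open>s\<close> that contains the point
\<open>p\<close> of the product \<open>Z\<close> of the two spaces; the balls of even levels lie in the first space, those of odd
levels in the second. Hence \<open>h s\<close> refines \<open>h (s + 2)\<close>, but there is no relation between \<open>h s\<close> and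
\<open>h (s + 1)\<close> on \<open>Z\<close>. The bounds on \<open>K s\<close> place it strictly between \<open>m * c s\<close> and \<open>m * (c s + 1)\<close> for
\<open>m = c (s + 1)\<close> and for \<open>m = c (s + 1) + 1\<close>.\<close>

locale alternating_labels =
  fixes Z :: "'z set" and h :: "nat \<Rightarrow> 'z \<Rightarrow> 'l" and c K :: "nat \<Rightarrow> nat"
  assumes coarsen: "\<lbrakk>p \<in> Z; q \<in> Z; h s p = h s q\<rbrakk> \<Longrightarrow> h (s + 2) p = h (s + 2) q"
    and count: "p \<in> Z \<Longrightarrow> card (h s ` {q \<in> Z. h (s + 2) q = h (s + 2) p}) = K s"
    and c_0_pos: "0 < c 0"
    and K_gt: "(c (s + 1) + 1) * c s < K s"
    and K_less: "K s < c (s + 1) * (c s + 1)"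
    and crossing: "\<lbrakk>p \<in> Z; q \<in> Z\<rbrakk> \<Longrightarrow> \<exists>z\<in>Z. h 0 z = h 0 p \<and> h 1 z = h 1 q"
    and exhaust: "\<lbrakk>p \<in> Z; q \<in> Z\<rbrakk> \<Longrightarrow> \<exists>n. h (2 * n + j) p = h (2 * n + j) q"
begin

lemma coarsen_iterate:
  assumes "p \<in> Z" "q \<in> Z" "h s p = h s q"
  shows "h (s + 2 * k) p = h (s + 2 * k) q"
proof (induction k)
  case 0
  then show ?case using assms by simp
next
  case (Suc k)
  then show ?case using coarsen[OF assms(1,2) Suc] by (simp add: algebra_simps)
qed

lemma c_pos: "0 < c s"
proof (cases s)
  case (Suc t)
  then show ?thesis using K_less[of t] by (cases "c s") auto
qed (simp add: c_0_pos)

lemma c_le_K: "c s \<le> K s"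
  using K_gt[of s] by simp

text \<open>A partial solution: the node \<open>a\<close> of level \<open>s + 1\<close> receives the set \<open>D\<close> of nodes of level \<open>s\<close> as its
children, and \<open>R\<close> encodes the tree below \<open>a\<close>. The residues modulo 2 stand for the bottom level, 0 or 1,
of the space to which a level belongs, so that the last two conditions say that no ball of the
bottom levels is missed.\<close>

definition matching :: "nat \<Rightarrow> 'l \<Rightarrow> 'l set \<Rightarrow> 'z set \<Rightarrow> bool" where
  "matching s a D R \<longleftrightarrow>
     R \<subseteq> Z \<and> (\<forall>p\<in>R. h (Suc s) p = a \<and> h s p \<in> D) \<and>
     (\<forall>i\<le>s. \<forall>p\<in>R. \<forall>q\<in>R. h i p = h i q \<longrightarrow> h (Suc i) p = h (Suc i) q) \<and>
     (\<forall>z\<in>Z. h (Suc s) z = a \<longrightarrow> (\<exists>p\<in>R. h (Suc s mod 2) p = h (Suc s mod 2) z)) \<and>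
     (\<forall>z\<in>Z. h s z \<in> D \<longrightarrow> (\<exists>p\<in>R. h (s mod 2) p = h (s mod 2) z))"

lemma matchingD:
  assumes "matching s a D R"
  shows "R \<subseteq> Z" "p \<in> R \<Longrightarrow> h (Suc s) p = a" "p \<in> R \<Longrightarrow> h s p \<in> D"
    "\<lbrakk>i \<le> s; p \<in> R; q \<in> R; h i p = h i q\<rbrakk> \<Longrightarrow> h (Suc i) p = h (Suc i) q"
    "\<lbrakk>z \<in> Z; h (Suc s) z = a\<rbrakk> \<Longrightarrow> \<exists>p\<in>R. h (Suc s mod 2) p = h (Suc s mod 2) z"
    "\<lbrakk>z \<in> Z; h s z \<in> D\<rbrakk> \<Longrightarrow> \<exists>p\<in>R. h (s mod 2) p = h (s mod 2) z"
  using assms unfolding matching_def by blast+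

lemma matching_0:
  assumes "a \<in> h 1 ` Z" "D \<subseteq> h 0 ` Z" "D \<noteq> {}"
  shows "matching 0 a D {z \<in> Z. h 1 z = a \<and> h 0 z \<in> D}"
proof -
  have ex: "\<exists>z\<in>Z. h 0 z = l \<and> h 1 z = a" if "l \<in> D" for l
    using that assms crossing by blast
  obtain d where "d \<in> D" using assms(3) by blast
  show ?thesis
    unfolding matching_def
  proof (intro conjI ballI impI allI)
    fix z assume "z \<in> Z" "h (Suc 0) z = a"
    then show "\<exists>p\<in>{z \<in> Z. h 1 z = a \<and> h 0 z \<in> D}. h (Suc 0 mod 2) p = h (Suc 0 mod 2) z"
      using ex[OF \<open>d \<in> D\<close>] \<open>d \<in> D\<close> by auto
  next
    fix z assume "z \<in> Z" "h 0 z \<in> D"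
    then show "\<exists>p\<in>{z \<in> Z. h 1 z = a \<and> h 0 z \<in> D}. h (0 mod 2) p = h (0 mod 2) z"
      using ex[of "h 0 z"] by auto
  qed auto
qed

text \<open>The inductive step. The \<open>K s\<close> sublabels of level \<open>s\<close> of the new top node are distributed among its
chosen children \<open>A\<close> in portions of size \<open>c s\<close> or \<open>c s + 1\<close>, and each child is matched with its portion.
Two points that belong to different children have different labels on all levels up to \<open>s + 1\<close>, so
that no condition links the pieces. Retaining a given piece \<open>R0\<close> makes it possible to pass to a limit.\<close>

lemma matching_extend:
  assumes pieces: "\<And>a D. \<lbrakk>a \<in> h (Suc s) ` Z; D \<subseteq> h s ` Z; card D \<in> {c s, c s + 1}\<rbrakk>
      \<Longrightarrow> \<exists>R. matching s a D R"
    and R0: "matching s a0 D0 R0" "card D0 \<in> {c s, c s + 1}"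
    and w: "w \<in> Z" "D0 \<subseteq> h s ` {q \<in> Z. h (s + 2) q = h (s + 2) w}"
    and A: "A \<subseteq> h (Suc s) ` Z" "a0 \<in> A" "card A \<in> {c (Suc s), c (Suc s) + 1}"
  shows "\<exists>R. R0 \<subseteq> R \<and> matching (Suc s) (h (s + 2) w) A R"
proof -
  define L where "L = h s ` {q \<in> Z. h (s + 2) q = h (s + 2) w}"
  have cardL: "card L = K s" using count w(1) by (simp add: L_def)
  have finL: "finite L" using cardL K_gt[of s] by (intro card_ge_0_finite) auto
  have finA: "finite A" using A(3) c_pos[of "Suc s"] by (intro card_ge_0_finite) auto
  have "card A * c s \<le> (c (s + 1) + 1) * c s" "c (s + 1) * (c s + 1) \<le> card A * (c s + 1)"
    using A(3) by auto
  then have "card A * c s < card L" "card L < card A * (c s + 1)"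
    using K_gt[of s] K_less[of s] cardL by linarith+
  then obtain g where g: "g ` L \<subseteq> A"
      "\<And>a. a \<in> A \<Longrightarrow> card {l \<in> L. g l = a} \<in> {c s, c s + 1}" "{l \<in> L. g l = a0} = D0"
    using balanced_assignment_extending[OF finA A(2) finL _ R0(2)] w(2) unfolding L_def by blast
  define D where "D a = {l \<in> L. g l = a}" for a
  have LZ: "L \<subseteq> h s ` Z" by (auto simp: L_def)
  have "\<exists>R. matching s a (D a) R \<and> (a = a0 \<longrightarrow> R = R0)" if "a \<in> A" for a
  proof (cases "a = a0")
    case True
    then show ?thesis using R0(1) g(3) by (auto simp: D_def)
  next
    case False
    have "D a \<subseteq> h s ` Z" "card (D a) \<in> {c s, c s + 1}" using LZ g(2) that by (auto simp: D_def)
    then show ?thesis using pieces[of a "D a"] A(1) that False by blast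
  qed
  then obtain S where S: "\<And>a. a \<in> A \<Longrightarrow> matching s a (D a) (S a)" "S a0 = R0"
    using A(2) by metis
  define R where "R = (\<Union>a\<in>A. S a)"
  have SZ: "S a \<subseteq> Z" if "a \<in> A" for a using matchingD(1)[OF S(1)[OF that]] .
  have Sa: "h (Suc s) p = a" "h s p \<in> L" "g (h s p) = a" if "a \<in> A" "p \<in> S a" for a p
    using matchingD(2,3)[OF S(1)[OF that(1)] that(2)] by (auto simp: D_def)
  have RZ: "R \<subseteq> Z" using SZ by (auto simp: R_def)
  have inC: "h (s + 2) p = h (s + 2) w" if p: "p \<in> R" for p
  proof -
    obtain q where "q \<in> Z" "h (s + 2) q = h (s + 2) w" "h s p = h s q"
      using p Sa(2) by (fastforce simp: R_def L_def)
    then show ?thesis using coarsen[of p q s] RZ p by auto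
  qed
  \<comment> \<open>A common label on level \<open>i\<close> propagates to whichever of the levels \<open>s\<close>, \<open>s + 1\<close> has the parity
    of \<open>i\<close>; the label on either of them determines the child.\<close>
  have separate: "a = b"
    if "a \<in> A" "b \<in> A" "p \<in> S a" "q \<in> S b" "i \<le> s" "h i p = h i q" for a b p q i
  proof -
    have Z: "p \<in> Z" "q \<in> Z" using that SZ by auto
    have "h s p = h s q \<or> h (Suc s) p = h (Suc s) q"
    proof (cases "even (s - i)")
      case True
      then obtain k where "s = i + 2 * k" using \<open>i \<le> s\<close>
        by (metis evenE le_add_diff_inverse)
      then show ?thesis using coarsen_iterate[OF Z that(6)] by auto
    next
      case False
      then obtain k where "Suc s = i + 2 * k" using \<open>i \<le> s\<close>
        by (metis Suc_diff_le evenE even_Suc le_SucI le_add_diff_inverse)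
      then show ?thesis using coarsen_iterate[OF Z that(6)] by auto
    qed
    then show ?thesis using Sa that by metis
  qed
  have nice: "h (Suc i) p = h (Suc i) q"
    if i: "i \<le> Suc s" and p: "p \<in> R" and q: "q \<in> R" and eq: "h i p = h i q" for i p q
  proof (cases "i = Suc s")
    case True
    then show ?thesis using inC[OF p] inC[OF q] by simp
  next
    case False
    then have i': "i \<le> s" using i by simp
    obtain a b where ab: "a \<in> A" "p \<in> S a" "b \<in> A" "q \<in> S b" using p q by (auto simp: R_def)
    have "a = b" using separate[OF ab(1,3,2,4) i' eq] .
    then show ?thesis using matchingD(4)[OF S(1)[OF ab(1)] i' ab(2) _ eq] ab(4) by simp
  qed
  have full1: "\<exists>p\<in>R. h (s mod 2) p = h (s mod 2) z" if z: "z \<in> Z" "h (s + 2) z = h (s + 2) w" for z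
  proof -
    have l: "h s z \<in> L" using z by (auto simp: L_def)
    then have "g (h s z) \<in> A" "h s z \<in> D (g (h s z))" using g(1) by (auto simp: D_def)
    then show ?thesis using matchingD(6)[OF S(1) z(1)] unfolding R_def by blast
  qed
  have full2: "\<exists>p\<in>R. h (Suc s mod 2) p = h (Suc s mod 2) z" if z: "z \<in> Z" "h (Suc s) z \<in> A" for z
    using matchingD(5)[OF S(1)[OF z(2)] z(1) refl] z(2) unfolding R_def by blast
  have "matching (Suc s) (h (s + 2) w) A R"
    unfolding matching_def
  proof (intro conjI ballI impI allI)
    fix p assume p: "p \<in> R"
    show "h (Suc (Suc s)) p = h (s + 2) w" using inC[OF p] by simp
    obtain a where "a \<in> A" "p \<in> S a" using p by (auto simp: R_def)
    then show "h (Suc s) p \<in> A" using Sa(1) by simp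
  next
    fix z assume "z \<in> Z" "h (Suc (Suc s)) z = h (s + 2) w"
    then show "\<exists>p\<in>R. h (Suc (Suc s) mod 2) p = h (Suc (Suc s) mod 2) z"
      using full1[of z] mod_add_self2[of s 2] by (simp del: mod_add_self2)
  next
    show "R \<subseteq> Z" by (rule RZ)
  next
    fix i p q assume "i \<le> Suc s" "p \<in> R" "q \<in> R" "h i p = h i q"
    then show "h (Suc i) p = h (Suc i) q" by (rule nice)
  next
    fix z assume "z \<in> Z" "h (Suc s) z \<in> A"
    then show "\<exists>p\<in>R. h (Suc s mod 2) p = h (Suc s mod 2) z" by (rule full2)
  qed
  moreover have "R0 \<subseteq> R" using S(2) A(2) by (auto simp: R_def)
  ultimately show ?thesis by blast
qed

text \<open>The children of a node can be chosen arbitrarily, not only among neighbours: only their number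
matters. This is why the induction goes through without any coherence between different nodes.\<close>

lemma matching_exists:
  "\<lbrakk>a \<in> h (Suc s) ` Z; D \<subseteq> h s ` Z; card D \<in> {c s, c s + 1}\<rbrakk> \<Longrightarrow> \<exists>R. matching s a D R"
proof (induction s arbitrary: a D)
  case 0
  then have "D \<noteq> {}" using c_0_pos by auto
  then show ?case using matching_0[of a D] 0(1,2) unfolding One_nat_def by blast
next
  case (Suc s)
  obtain w where w: "w \<in> Z" "a = h (s + 2) w" using Suc.prems(1) by auto
  have "D \<noteq> {}" using Suc.prems(3) c_pos[of "Suc s"] by auto
  then obtain a0 where a0: "a0 \<in> D" by blast
  have "c s \<le> card (h s ` {q \<in> Z. h (s + 2) q = h (s + 2) w})"
    unfolding count[OF w(1)] by (rule c_le_K)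
  from obtain_subset_with_card_n[OF this]
  obtain D0 where D0: "D0 \<subseteq> h s ` {q \<in> Z. h (s + 2) q = h (s + 2) w}" "card D0 = c s" by blast
  have "h s ` {q \<in> Z. h (s + 2) q = h (s + 2) w} \<subseteq> h s ` Z" by (intro image_mono) simp
  with D0(1) have D0Z: "D0 \<subseteq> h s ` Z" by (rule subset_trans)
  have a0Z: "a0 \<in> h (Suc s) ` Z" using Suc.prems(2) a0 by (rule subsetD)
  have cD0: "card D0 \<in> {c s, c s + 1}" using D0(2) by simp
  obtain R0 where R0: "matching s a0 D0 R0"
    using Suc.IH[OF a0Z D0Z cD0] ..
  have "\<exists>R. R0 \<subseteq> R \<and> matching (Suc s) (h (s + 2) w) D R"
    by (rule matching_extend[OF Suc.IH R0 cD0 w(1) D0(1) Suc.prems(2) a0 Suc.prems(3)])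
  then show ?case unfolding w(2) by blast
qed

text \<open>The nodes on the path from a base point \<open>z0\<close> to the root at infinity are matched one after the other,
each time extending the previous matching. These nodes exhaust \<open>Z\<close>, so the union of the matchings
is a global solution.\<close>

lemma interleaved_subset_exists:
  assumes "Z \<noteq> {}"
  obtains R where "R \<subseteq> Z"
    "\<And>i p q. \<lbrakk>p \<in> R; q \<in> R; h i p = h i q\<rbrakk> \<Longrightarrow> h (Suc i) p = h (Suc i) q"
    "\<And>z. z \<in> Z \<Longrightarrow> \<exists>p\<in>R. h 0 p = h 0 z"
    "\<And>z. z \<in> Z \<Longrightarrow> \<exists>p\<in>R. h 1 p = h 1 z"
proof -
  obtain z0 where z0: "z0 \<in> Z" using assms by blast
  define L where "L s = h s ` {q \<in> Z. h (s + 2) q = h (s + 2) z0}" for s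
  have LZ: "L s \<subseteq> h s ` Z" for s by (auto simp: L_def)
  define P where "P s = (\<lambda>(D, R). D \<subseteq> L s \<and> card D \<in> {c s, c s + 1} \<and>
      matching s (h (Suc s) z0) D R)" for s
  \<comment> \<open>The children of each node on the path have to include the previous node of the path.\<close>
  have ex: "\<exists>D\<subseteq>L s. card D = c s \<and> h s z0 \<in> D" for s
  proof -
    have z0L: "h s z0 \<in> L s" using z0 by (auto simp: L_def)
    have "card (L s - {h s z0}) = K s - 1"
      using count[OF z0, of s] z0L by (simp add: L_def)
    then have "c s - 1 \<le> card (L s - {h s z0})" using c_le_K[of s] by simp
    then obtain D where D: "D \<subseteq> L s - {h s z0}" "card D = c s - 1" "finite D"
      using obtain_subset_with_card_n by metis
    have "card (insert (h s z0) D) = c s" using D c_pos[of s]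
      by (subst card_insert_disjoint) auto
    then show ?thesis using D(1) z0L by blast
  qed
  have "\<exists>F. \<forall>s. P s (F s) \<and> snd (F s) \<subseteq> snd (F (Suc s))"
  proof (rule dependent_nat_choice)
    obtain D where D: "D \<subseteq> L 0" "card D = c 0" using ex by blast
    then obtain R where "matching 0 (h (Suc 0) z0) D R"
      using matching_exists[of "h (Suc 0) z0" 0 D] z0 LZ[of 0] by auto
    then show "\<exists>F. P 0 F" using D by (auto simp: P_def)
  next
    fix F s assume "P s F"
    then obtain D R where F: "F = (D, R)" "D \<subseteq> L s" "card D \<in> {c s, c s + 1}"
        "matching s (h (Suc s) z0) D R"
      by (auto simp: P_def)
    obtain A where A: "A \<subseteq> L (Suc s)" "card A = c (Suc s)" "h (Suc s) z0 \<in> A"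
      using ex by blast
    then have "\<exists>R'. R \<subseteq> R' \<and> matching (Suc s) (h (s + 2) z0) A R'"
      using matching_extend[OF matching_exists F(4,3) z0, of A] F(2) LZ[of "Suc s"]
      by (auto simp: L_def)
    then show "\<exists>F'. P (Suc s) F' \<and> snd F \<subseteq> snd F'"
      using A F(1) by (auto simp: P_def)
  qed
  then obtain F where F: "\<And>s. P s (F s)" "\<And>s. snd (F s) \<subseteq> snd (F (Suc s))" by blast
  define S where "S s = snd (F s)" for s
  have S: "\<exists>D. matching s (h (Suc s) z0) D (S s)" for s
    using F(1)[of s] by (auto simp: P_def S_def)
  have mono: "S s \<subseteq> S t" if "s \<le> t" for s t
    using lift_Suc_mono_le[of S s t] that F(2) by (simp add: S_def)
  define R where "R = (\<Union>s. S s)"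
  have "R \<subseteq> Z" using matchingD(1) S unfolding R_def by blast
  moreover have "h (Suc i) p = h (Suc i) q" if pq: "p \<in> R" "q \<in> R" "h i p = h i q" for i p q
  proof -
    obtain s t where "p \<in> S s" "q \<in> S t" using pq by (auto simp: R_def)
    define m where "m = max i (max s t)"
    have m: "i \<le> m" "s \<le> m" "t \<le> m" by (auto simp: m_def)
    obtain D where D: "matching m (h (Suc m) z0) D (S m)" using S by blast
    have "p \<in> S m" "q \<in> S m"
      using mono[OF m(2)] mono[OF m(3)] \<open>p \<in> S s\<close> \<open>q \<in> S t\<close> by blast+
    then show ?thesis using matchingD(4)[OF D m(1)] pq(3) by blast
  qed
  moreover have full: "\<exists>p\<in>R. h (Suc s mod 2) p = h (Suc s mod 2) z"
    if "z \<in> Z" "h (Suc s) z = h (Suc s) z0" for z s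
    using S[of s] matchingD(5)[OF _ that] unfolding R_def by blast
  moreover have "\<exists>p\<in>R. h 0 p = h 0 z" if z: "z \<in> Z" for z
  proof -
    obtain n where "h (2 * n + 2) z = h (2 * n + 2) z0" using exhaust[OF z z0] by blast
    then show ?thesis using full[OF z, of "2 * n + 1"] by simp
  qed
  moreover have "\<exists>p\<in>R. h 1 p = h 1 z" if z: "z \<in> Z" for z
  proof -
    obtain n where "h (2 * n + 1) z = h (2 * n + 1) z0" using exhaust[OF z z0] by blast
    then show ?thesis using full[OF z, of "2 * n"] by simp
  qed
  ultimately show thesis using that by blast
qed

end

section \<open>Balls in homogeneous proper ultrametric spaces\<close>

context Metric_space
begin

lemma ultrametric_mcball_eq_iff:
  assumes "multrametric" "x \<in> M" "y \<in> M" "0 \<le> r"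
  shows "mcball x r = mcball y r \<longleftrightarrow> d x y \<le> r"
proof
  assume "mcball x r = mcball y r"
  then show "d x y \<le> r" using assms by (metis centre_in_mcball_iff in_mcball)
next
  have sub: "mcball v r \<subseteq> mcball u r" if "u \<in> M" "v \<in> M" "d u v \<le> r" for u v
  proof
    fix z assume "z \<in> mcball v r"
    then have z: "z \<in> M" "d v z \<le> r" by auto
    have "d u z \<le> max (d u v) (d v z)" using assms(1) that z by (auto simp: multrametric_def)
    then show "z \<in> mcball u r" using that z by auto
  qed
  assume "d x y \<le> r"
  then show "mcball x r = mcball y r"
    using sub[of x y] sub[of y x] assms by (simp add: commute subset_antisym)
qed

lemma ultrametric_openin_mcball:
  assumes "multrametric" "x \<in> M" "0 < r"
  shows "openin mtopology (mcball x r)"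
  unfolding openin_mtopology
proof (intro conjI allI impI)
  fix y assume "y \<in> mcball x r"
  then have "mcball y r = mcball x r"
    using ultrametric_mcball_eq_iff[OF assms(1), of y x r] assms by (auto simp: commute)
  then show "\<exists>r'>0. mball y r' \<subseteq> mcball x r"
    using assms(3) mball_subset_mcball by metis
qed auto

text \<open>Balls of radius \<open>r\<close> are open and equal or disjoint, so a cover of a compact ball by them has no proper
subcover.\<close>

lemma ultrametric_finite_subballs:
  assumes "multrametric" "mproper" "x \<in> M" "0 < r"
  shows "finite ((\<lambda>y. mcball y r) ` mcball x R)"
proof (cases "0 \<le> R")
  case True
  let ?U = "(\<lambda>y. mcball y r) ` mcball x R"
  have "compactin mtopology (mcball x R)"
    using assms True by (simp add: mproper_def)
  moreover have "\<forall>U\<in>?U. openin mtopology U"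
    using ultrametric_openin_mcball assms by auto
  moreover have "mcball x R \<subseteq> \<Union>?U"
    using assms(4) by fastforce
  ultimately obtain F where F: "finite F" "F \<subseteq> ?U" "mcball x R \<subseteq> \<Union>F"
    unfolding compactin_def by meson
  have "?U \<subseteq> F"
  proof
    fix U assume "U \<in> ?U"
    then obtain y where y: "y \<in> mcball x R" "U = mcball y r" by blast
    then obtain V where V: "V \<in> F" "y \<in> V" using F(3) by blast
    then obtain z where z: "z \<in> M" "V = mcball z r" using F(2) by force
    then have "V = U"
      using ultrametric_mcball_eq_iff[OF assms(1), of z y r] V y assms(4) by auto
    then show "U \<in> F" using V(1) by simp
  qed
  then show ?thesis using F(1) finite_subset by blast
next
  case False
  then have "mcball x R = {}" by (simp add: mcball_eq_empty)
  then show ?thesis by simp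
qed

lemma homogeneous_card_subballs:
  assumes "mhomogeneous" "x \<in> M" "y \<in> M"
  shows "card ((\<lambda>z. mcball z r) ` mcball x R) = card ((\<lambda>z. mcball z r) ` mcball y R)"
proof -
  obtain f where f: "bij_betw f M M" "\<And>u v. \<lbrakk>u \<in> M; v \<in> M\<rbrakk> \<Longrightarrow> d (f u) (f v) = d u v" "f x = y"
    using assms unfolding mhomogeneous_def by blast
  have fM: "f u \<in> M" if "u \<in> M" for u using f(1) that by (auto simp: bij_betw_def)
  have ball: "mcball (f u) s = f ` mcball u s" if u: "u \<in> M" for u s
  proof
    show "f ` mcball u s \<subseteq> mcball (f u) s" using f(2) fM u by auto
    show "mcball (f u) s \<subseteq> f ` mcball u s"
    proof
      fix v assume v: "v \<in> mcball (f u) s"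
      then obtain w where "w \<in> M" "v = f w" using f(1) by (auto simp: bij_betw_def)
      then show "v \<in> f ` mcball u s" using f(2)[OF u] v u by auto
    qed
  qed
  have "(\<lambda>z. mcball z r) ` mcball y R = (\<lambda>z. mcball (f z) r) ` mcball x R"
    using ball[OF assms(2), of R] f(3) by (simp add: image_image)
  also have "\<dots> = image f ` (\<lambda>z. mcball z r) ` mcball x R"
    unfolding image_image by (intro image_cong refl ball) auto
  also have "card \<dots> = card ((\<lambda>z. mcball z r) ` mcball x R)"
  proof (rule card_image)
    have "inj_on f M" using f(1) by (simp add: bij_betw_def)
    then show "inj_on (image f) ((\<lambda>z. mcball z r) ` mcball x R)"
      by (intro inj_on_subset[OF inj_on_image_Pow]) auto
  qed
  finally show ?thesis by simp
qed

text \<open>Finitely many balls of radius \<open>r\<close> cannot cover an unbounded space.\<close>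

lemma ultrametric_many_subballs:
  assumes "multrametric" "mproper" "x \<in> M" "0 < r"
  shows "\<exists>R0. \<forall>R\<ge>R0. N \<le> card ((\<lambda>y. mcball y r) ` mcball x R)"
proof -
  have "infinite ((\<lambda>y. mcball y r) ` M)"
  proof
    assume "finite ((\<lambda>y. mcball y r) ` M)"
    then have "mbounded (\<Union>((\<lambda>y. mcball y r) ` M))"
      by (intro mbounded_Union) (auto simp: mbounded_mcball)
    moreover have "M \<subseteq> \<Union>((\<lambda>y. mcball y r) ` M)" using assms(4) by fastforce
    ultimately have "mbounded M" using mbounded_subset by blast
    then show False using assms(2) by (simp add: mproper_def)
  qed
  then obtain F where F: "F \<subseteq> (\<lambda>y. mcball y r) ` M" "card F = N" "finite F"
    by (meson infinite_arbitrarily_large)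
  then obtain G where G: "G \<subseteq> M" "finite G" "F = (\<lambda>y. mcball y r) ` G"
    using finite_subset_image[OF F(3,1)] by blast
  define R0 where "R0 = Max (insert 0 (d x ` G))"
  have "N \<le> card ((\<lambda>y. mcball y r) ` mcball x R)" if "R0 \<le> R" for R
  proof -
    have "d x y \<le> R" if "y \<in> G" for y
      using that \<open>R0 \<le> R\<close> G(2) unfolding R0_def
      by (metis Max_ge finite_imageI finite_insert image_eqI insertCI order_trans)
    then have "G \<subseteq> mcball x R" using G(1) assms(3) by auto
    then have "F \<subseteq> (\<lambda>y. mcball y r) ` mcball x R" using G(3) by blast
    then show ?thesis
      using F(2) ultrametric_finite_subballs[OF assms] card_mono by metis
  qed
  then show ?thesis by blast
qed

end

text \<open>Radii and branching numbers have to be chosen together: how large \<open>\<rho> (s + 2)\<close> must be depends on \<open>c s\<close>,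
and \<open>c (s + 1)\<close> is determined by the count that results.\<close>

lemma interleaved_scales_exist:
  fixes \<kappa> :: "nat \<Rightarrow> real \<Rightarrow> real \<Rightarrow> nat"
  assumes "\<And>s r N. 0 < r \<Longrightarrow> \<exists>R0. \<forall>R\<ge>R0. N \<le> \<kappa> s r R"
  obtains \<rho> :: "nat \<Rightarrow> real" and c :: "nat \<Rightarrow> nat"
  where "\<And>s. 0 < \<rho> s" "\<And>s. \<rho> s + 1 \<le> \<rho> (s + 2)" "0 < c 0"
    "\<And>s. (c (s + 1) + 1) * c s < \<kappa> s (\<rho> s) (\<rho> (s + 2))"
    "\<And>s. \<kappa> s (\<rho> s) (\<rho> (s + 2)) < c (s + 1) * (c s + 1)"
proof -
  define Q where "Q s = (\<lambda>(a :: real, b :: real, m) (a' :: real, b' :: real, m'). a' = b \<and> a + 1 \<le> b' \<and>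
      (m' + 1) * m < \<kappa> s a b' \<and> \<kappa> s a b' < m' * (m + 1))"
    for s
  define P where "P = (\<lambda>(a :: real, b :: real, m :: nat). 0 < a \<and> 0 < b \<and> 0 < m)"
  have "\<exists>F. \<forall>s. P (F s) \<and> Q s (F s) (F (Suc s))"
  proof (rule dependent_nat_choice)
    show "\<exists>x. P x"
      by (rule exI[of _ "(1, 1, 1)"]) (simp add: P_def)
  next
    fix x s assume "P x"
    then obtain a b :: real and m :: nat where x: "x = (a, b, m)" "0 < a" "0 < b" "0 < m"
      by (cases x) (auto simp: P_def)
    obtain R0 where R0: "\<And>R. R \<ge> R0 \<Longrightarrow> (2 * m + 2) * m + 1 \<le> \<kappa> s a R"
      using assms[OF x(2)] by blast
    define b' where "b' = max R0 (a + 1)"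
    \<comment> \<open>With \<open>m' = k div m - 1\<close>, the bound \<open>(m' + 1) * m \<le> k\<close> is immediate, and \<open>k + 1 < m' * (m + 1)\<close>
      follows from \<open>2 * m < m'\<close>, because \<open>k < (m' + 2) * m\<close>.\<close>
    define k where "k = \<kappa> s a b' - 1"
    have k: "(2 * m + 2) * m \<le> k" "\<kappa> s a b' = k + 1"
      using R0[of b'] by (auto simp: k_def b'_def)
    define m' where "m' = k div m - 1"
    have "2 * m + 2 \<le> k div m" using k(1) x(4) by (simp add: less_eq_div_iff_mult_less_eq)
    then have m': "k div m = m' + 1" "2 * m + 1 \<le> m'" by (auto simp: m'_def)
    have "k = (m' + 1) * m + k mod m" using m'(1) by (metis div_mult_mod_eq)
    moreover have "k mod m < m" using x(4) by simp
    ultimately have "(m' + 1) * m < k + 1" "k + 1 < m' * (m + 1)"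
      using m'(2) by (auto simp: algebra_simps)
    then have "Q s x (b, b', m')" using x(1) k(2) by (auto simp: Q_def b'_def)
    moreover have "0 < b'" "0 < m'" using x(2) m'(2) by (auto simp: b'_def)
    ultimately show "\<exists>y. P y \<and> Q s x y"
      using x(3) by (intro exI[of _ "(b, b', m')"]) (simp add: P_def)
  qed
  then obtain F where F: "\<And>s. P (F s)" "\<And>s. Q s (F s) (F (Suc s))" by blast
  define \<rho> where "\<rho> s = fst (F s)" for s
  define c where "c s = snd (snd (F s))" for s
  have next_\<rho>: "fst (snd (F s)) = \<rho> (Suc s)" for s
    using F(2)[of s] by (auto simp: Q_def \<rho>_def split: prod.splits)
  have step: "\<rho> s + 1 \<le> \<rho> (s + 2) \<and> (c (s + 1) + 1) * c s < \<kappa> s (\<rho> s) (\<rho> (s + 2)) \<and>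
      \<kappa> s (\<rho> s) (\<rho> (s + 2)) < c (s + 1) * (c s + 1)" for s
    using F(2)[of s] next_\<rho>[of "Suc s"] next_\<rho>[of s]
    by (simp add: Q_def \<rho>_def c_def case_prod_beta)
  have "0 < \<rho> s" "0 < c s" for s using F(1)[of s] by (auto simp: P_def \<rho>_def c_def split: prod.splits)
  then show thesis using that step by blast
qed

section \<open>Coarse equivalence of homogeneous proper ultrametric spaces\<close>

context Metric_space12
begin

text \<open>The product \<open>M1 \<times> M2\<close> is labelled by balls of the two spaces alternately, and the alternating tree
yields a relation \<open>R\<close>. The map \<open>f\<close> sends \<open>x\<close> to a partner of some point in the ball of radius \<open>\<rho> 0\<close>
around \<open>x\<close>, and \<open>g\<close> does the same with balls of radius \<open>\<rho> 1\<close> in the other direction.\<close>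

lemma homogeneous_ultrametric_coarse_equivalence:
  assumes hom: "M1.mhomogeneous" "M2.mhomogeneous"
    and proper: "M1.mproper" "M2.mproper"
    and ultra: "M1.multrametric" "M2.multrametric"
  obtains f g C \<delta> where "f \<in> M1 \<rightarrow> M2" "g \<in> M2 \<rightarrow> M1" "0 < \<delta>"
    "\<And>x x'. \<lbrakk>x \<in> M1; x' \<in> M1; d1 x x' \<le> \<delta>\<rbrakk> \<Longrightarrow> f x = f x'"
    "\<And>y y'. \<lbrakk>y \<in> M2; y' \<in> M2; d2 y y' \<le> \<delta>\<rbrakk> \<Longrightarrow> g y = g y'"
    "\<forall>r. \<exists>s. \<forall>x\<in>M1. \<forall>x'\<in>M1. d1 x x' \<le> r \<longrightarrow> d2 (f x) (f x') \<le> s"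
    "\<forall>r. \<exists>s. \<forall>y\<in>M2. \<forall>y'\<in>M2. d2 y y' \<le> r \<longrightarrow> d1 (g y) (g y') \<le> s"
    "\<And>x. x \<in> M1 \<Longrightarrow> d1 x (g (f x)) \<le> C" "\<And>y. y \<in> M2 \<Longrightarrow> d2 y (f (g y)) \<le> C"
proof -
  have "M1 \<noteq> {}" "M2 \<noteq> {}"
    using proper M1.mbounded_empty M2.mbounded_empty
    unfolding M1.mproper_def M2.mproper_def by metis+
  then obtain x0 y0 where x0: "x0 \<in> M1" and y0: "y0 \<in> M2" by blast
  define \<kappa> where "\<kappa> s r R =
    (if even s then card ((\<lambda>x. M1.mcball x r) ` M1.mcball x0 R)
     else card ((\<lambda>y. M2.mcball y r) ` M2.mcball y0 R))" for s :: nat and r R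
  have large: "\<exists>R0. \<forall>R\<ge>R0. N \<le> \<kappa> s r R" if "0 < r" for s r N
    using M1.ultrametric_many_subballs[OF ultra(1) proper(1) x0 that, of N]
      M2.ultrametric_many_subballs[OF ultra(2) proper(2) y0 that, of N]
    by (cases "even s") (simp_all add: \<kappa>_def)
  obtain \<rho> c where \<rho>: "\<And>s. 0 < \<rho> s" "\<And>s. \<rho> s + 1 \<le> \<rho> (s + 2)" and c0: "0 < c 0"
    and c: "\<And>s. (c (s + 1) + 1) * c s < \<kappa> s (\<rho> s) (\<rho> (s + 2))"
      "\<And>s. \<kappa> s (\<rho> s) (\<rho> (s + 2)) < c (s + 1) * (c s + 1)"
    using interleaved_scales_exist[of \<kappa>, OF large] by blast
  have \<rho>_unbounded: "\<rho> j + real n \<le> \<rho> (2 * n + j)" for n j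
  proof (induction n)
    case (Suc n)
    then show ?case using \<rho>(2)[of "2 * n + j"] by (simp add: algebra_simps)
  qed simp
  define h where "h s p = (if even s then Inl (M1.mcball (fst p) (\<rho> s)) else Inr (M2.mcball (snd p) (\<rho> s)))"
    for s and p :: "'a \<times> 'b"
  have h_eq: "h s p = h s q \<longleftrightarrow>
      (if even s then d1 (fst p) (fst q) \<le> \<rho> s else d2 (snd p) (snd q) \<le> \<rho> s)"
    if "p \<in> M1 \<times> M2" "q \<in> M1 \<times> M2" for s p q
    using that M1.ultrametric_mcball_eq_iff[OF ultra(1), of "fst p" "fst q" "\<rho> s"]
      M2.ultrametric_mcball_eq_iff[OF ultra(2), of "snd p" "snd q" "\<rho> s"] \<rho>(1)[of s]
    by (simp add: h_def mem_Times_iff)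
  interpret alternating_labels "M1 \<times> M2" h c "\<lambda>s. \<kappa> s (\<rho> s) (\<rho> (s + 2))"
  proof
    fix p q s assume pq: "p \<in> M1 \<times> M2" "q \<in> M1 \<times> M2" "h s p = h s q"
    then show "h (s + 2) p = h (s + 2) q"
      using \<rho>(2)[of s] by (auto simp: h_eq split: if_splits)
  next
    fix p s assume p: "p \<in> M1 \<times> M2"
    let ?C = "{q \<in> M1 \<times> M2. h (s + 2) q = h (s + 2) p}"
    show "card (h s ` ?C) = \<kappa> s (\<rho> s) (\<rho> (s + 2))"
    proof (cases "even s")
      case True
      have "?C = M1.mcball (fst p) (\<rho> (s + 2)) \<times> M2"
        using p True by (auto simp: h_eq M1.commute)
      then have "fst ` ?C = M1.mcball (fst p) (\<rho> (s + 2))"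
        using y0 by auto
      moreover have "h s ` ?C = Inl ` (\<lambda>x. M1.mcball x (\<rho> s)) ` fst ` ?C"
        using True by (simp add: h_def image_image)
      ultimately have "h s ` ?C = Inl ` (\<lambda>x. M1.mcball x (\<rho> s)) ` M1.mcball (fst p) (\<rho> (s + 2))"
        by simp
      then have "card (h s ` ?C) = card ((\<lambda>x. M1.mcball x (\<rho> s)) ` M1.mcball (fst p) (\<rho> (s + 2)))"
        by (simp add: card_image)
      then show ?thesis
        using M1.homogeneous_card_subballs[OF hom(1) _ x0, of "fst p"] p True
        by (simp add: \<kappa>_def mem_Times_iff)
    next
      case False
      have "?C = M1 \<times> M2.mcball (snd p) (\<rho> (s + 2))"
        using p False by (auto simp: h_eq M2.commute)
      then have "snd ` ?C = M2.mcball (snd p) (\<rho> (s + 2))"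
        using x0 by auto
      moreover have "h s ` ?C = Inr ` (\<lambda>y. M2.mcball y (\<rho> s)) ` snd ` ?C"
        using False by (simp add: h_def image_image)
      ultimately have "h s ` ?C = Inr ` (\<lambda>y. M2.mcball y (\<rho> s)) ` M2.mcball (snd p) (\<rho> (s + 2))"
        by simp
      then have "card (h s ` ?C) = card ((\<lambda>y. M2.mcball y (\<rho> s)) ` M2.mcball (snd p) (\<rho> (s + 2)))"
        by (simp add: card_image)
      then show ?thesis
        using M2.homogeneous_card_subballs[OF hom(2) _ y0, of "snd p"] p False
        by (simp add: \<kappa>_def mem_Times_iff)
    qed
  next
    fix p q assume "p \<in> M1 \<times> M2" "q \<in> M1 \<times> M2"
    then show "\<exists>z\<in>M1 \<times> M2. h 0 z = h 0 p \<and> h 1 z = h 1 q"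
      by (intro bexI[of _ "(fst p, snd q)"]) (auto simp: h_def)
  next
    fix p q j assume pq: "p \<in> M1 \<times> M2" "q \<in> M1 \<times> M2"
    obtain n where n: "max (d1 (fst p) (fst q)) (d2 (snd p) (snd q)) \<le> real n"
      using real_arch_simple by blast
    then have "h (2 * n + j) p = h (2 * n + j) q"
      using \<rho>_unbounded[of j n] \<rho>(1)[of j] pq by (simp add: h_eq)
    then show "\<exists>n. h (2 * n + j) p = h (2 * n + j) q" by blast
  qed (use c0 c in auto)
  obtain R where R: "R \<subseteq> M1 \<times> M2"
      "\<And>i p q. \<lbrakk>p \<in> R; q \<in> R; h i p = h i q\<rbrakk> \<Longrightarrow> h (Suc i) p = h (Suc i) q"
    and full: "\<And>z. z \<in> M1 \<times> M2 \<Longrightarrow> \<exists>p\<in>R. h 0 p = h 0 z" "\<And>z. z \<in> M1 \<times> M2 \<Longrightarrow> \<exists>p\<in>R. h 1 p = h 1 z"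
    using interleaved_subset_exists x0 y0 by blast
  have R12: "d2 (snd p) (snd q) \<le> \<rho> (Suc i)"
    if "p \<in> R" "q \<in> R" "d1 (fst p) (fst q) \<le> \<rho> i" "even i" for p q i
    using R(2)[OF that(1,2), of i] that R(1) h_eq[of p q i] h_eq[of p q "Suc i"] by auto
  have R21: "d1 (fst p) (fst q) \<le> \<rho> (Suc i)"
    if "p \<in> R" "q \<in> R" "d2 (snd p) (snd q) \<le> \<rho> i" "odd i" for p q i
    using R(2)[OF that(1,2), of i] that R(1) h_eq[of p q i] h_eq[of p q "Suc i"] by auto
  \<comment> \<open>The choice depends only on the ball around the point, which makes the maps constant on balls.\<close>
  define P where "P x = (SOME p. p \<in> R \<and> M1.mcball (fst p) (\<rho> 0) = M1.mcball x (\<rho> 0))" for x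
  define Q where "Q y = (SOME p. p \<in> R \<and> M2.mcball (snd p) (\<rho> 1) = M2.mcball y (\<rho> 1))" for y
  have P: "P x \<in> R" "M1.mcball (fst (P x)) (\<rho> 0) = M1.mcball x (\<rho> 0)" if x: "x \<in> M1" for x
  proof -
    obtain p where "p \<in> R" "h 0 p = h 0 (x, y0)" using full(1)[of "(x, y0)"] x y0 by blast
    then have "\<exists>p. p \<in> R \<and> M1.mcball (fst p) (\<rho> 0) = M1.mcball x (\<rho> 0)"
      by (intro exI[of _ p]) (simp add: h_def)
    from someI_ex[OF this] show "P x \<in> R" "M1.mcball (fst (P x)) (\<rho> 0) = M1.mcball x (\<rho> 0)"
      by (simp_all add: P_def)
  qed
  have Q: "Q y \<in> R" "M2.mcball (snd (Q y)) (\<rho> 1) = M2.mcball y (\<rho> 1)" if y: "y \<in> M2" for y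
  proof -
    obtain p where "p \<in> R" "h 1 p = h 1 (x0, y)" using full(2)[of "(x0, y)"] y x0 by blast
    then have "\<exists>p. p \<in> R \<and> M2.mcball (snd p) (\<rho> 1) = M2.mcball y (\<rho> 1)"
      by (intro exI[of _ p]) (simp add: h_def)
    from someI_ex[OF this] show "Q y \<in> R" "M2.mcball (snd (Q y)) (\<rho> 1) = M2.mcball y (\<rho> 1)"
      by (simp_all add: Q_def)
  qed
  have PM: "fst (P x) \<in> M1" "snd (P x) \<in> M2" if "x \<in> M1" for x
    using P(1)[OF that] R(1) by auto
  have QM: "fst (Q y) \<in> M1" "snd (Q y) \<in> M2" if "y \<in> M2" for y
    using Q(1)[OF that] R(1) by auto
  have dP: "d1 x (fst (P x)) \<le> \<rho> 0" if "x \<in> M1" for x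
    using P(2)[OF that] M1.ultrametric_mcball_eq_iff[OF ultra(1), of x "fst (P x)" "\<rho> 0"] PM that \<rho>(1)[of 0]
    by simp
  have dQ: "d2 y (snd (Q y)) \<le> \<rho> 1" if "y \<in> M2" for y
    using Q(2)[OF that] M2.ultrametric_mcball_eq_iff[OF ultra(2), of y "snd (Q y)" "\<rho> 1"] QM that \<rho>(1)[of 1]
    by simp
  define \<delta> where "\<delta> = min (\<rho> 0) (\<rho> 1)"
  \<comment> \<open>The round trip \<open>g \<circ> f\<close> replaces \<open>x\<close> by the first coordinate of \<open>P x\<close>, at cost \<open>\<rho> 0\<close>, and then
    passes from level 1 to level 2, at cost \<open>\<rho> 2\<close>. Likewise \<open>f \<circ> g\<close> costs \<open>\<rho> 1\<close> to reach \<open>Q y\<close>, and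
    then \<open>\<rho> 1\<close> for the passage from level 0 to level 1.\<close>
  define C where "C = max (\<rho> 0 + \<rho> 2) (\<rho> 1 + \<rho> 1)"
  show thesis
  proof (rule that)
    show "(\<lambda>x. snd (P x)) \<in> M1 \<rightarrow> M2" "(\<lambda>y. fst (Q y)) \<in> M2 \<rightarrow> M1"
      using PM QM by auto
    show "0 < \<delta>" using \<rho>(1) by (simp add: \<delta>_def)
    show "snd (P x) = snd (P x')" if "x \<in> M1" "x' \<in> M1" "d1 x x' \<le> \<delta>" for x x'
      using M1.ultrametric_mcball_eq_iff[OF ultra(1) that(1,2), of "\<rho> 0"] \<rho>(1)[of 0] that(3)
      by (simp add: P_def \<delta>_def)
    show "fst (Q y) = fst (Q y')" if "y \<in> M2" "y' \<in> M2" "d2 y y' \<le> \<delta>" for y y'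
      using M2.ultrametric_mcball_eq_iff[OF ultra(2) that(1,2), of "\<rho> 1"] \<rho>(1)[of 1] that(3)
      by (simp add: Q_def \<delta>_def)
    show "d1 x (fst (Q (snd (P x)))) \<le> C" if x: "x \<in> M1" for x
    proof -
      let ?q = "Q (snd (P x))"
      have "d1 (fst (P x)) (fst ?q) \<le> \<rho> (Suc 1)"
        using R21[OF P(1)[OF x] Q(1)] dQ PM x by auto
      moreover have "d1 x (fst ?q) \<le> d1 x (fst (P x)) + d1 (fst (P x)) (fst ?q)"
        using M1.triangle x PM QM by auto
      ultimately show ?thesis using dP[OF x] by (simp add: C_def numeral_2_eq_2)
    qed
    show "d2 y (snd (P (fst (Q y)))) \<le> C" if y: "y \<in> M2" for y
    proof -
      let ?p = "P (fst (Q y))"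
      have "d2 (snd (Q y)) (snd ?p) \<le> \<rho> (Suc 0)"
        using R12[OF Q(1)[OF y] P(1)] dP QM y by auto
      moreover have "d2 y (snd ?p) \<le> d2 y (snd (Q y)) + d2 (snd (Q y)) (snd ?p)"
        using M2.triangle y PM QM by auto
      ultimately show ?thesis using dQ[OF y] by (simp add: C_def)
    qed
    show "\<forall>r. \<exists>s. \<forall>x\<in>M1. \<forall>x'\<in>M1. d1 x x' \<le> r \<longrightarrow> d2 (snd (P x)) (snd (P x')) \<le> s"
    proof (intro allI)
      fix r
      obtain n where n: "2 * \<rho> 0 + r \<le> real n" using real_arch_simple by blast
      have "d2 (snd (P x)) (snd (P x')) \<le> \<rho> (Suc (2 * n + 0))"
        if x: "x \<in> M1" "x' \<in> M1" "d1 x x' \<le> r" for x x'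
      proof (rule R12)
        have "d1 (fst (P x)) (fst (P x')) \<le> d1 (fst (P x)) x + (d1 x x' + d1 x' (fst (P x')))"
          using M1.triangle[of "fst (P x)" x "fst (P x')"] M1.triangle[of x x' "fst (P x')"] x PM by fastforce
        also have "\<dots> \<le> \<rho> 0 + (r + \<rho> 0)"
          using dP x by (intro add_mono) (auto simp: M1.commute)
        finally show "d1 (fst (P x)) (fst (P x')) \<le> \<rho> (2 * n + 0)"
          using n \<rho>_unbounded[of 0 n] \<rho>(1)[of 0] by simp
      qed (use P x in auto)
      then show "\<exists>s. \<forall>x\<in>M1. \<forall>x'\<in>M1. d1 x x' \<le> r \<longrightarrow> d2 (snd (P x)) (snd (P x')) \<le> s" by blast
    qed
    show "\<forall>r. \<exists>s. \<forall>y\<in>M2. \<forall>y'\<in>M2. d2 y y' \<le> r \<longrightarrow> d1 (fst (Q y)) (fst (Q y')) \<le> s"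
    proof (intro allI)
      fix r
      obtain n where n: "2 * \<rho> 1 + r \<le> real n" using real_arch_simple by blast
      have "d1 (fst (Q y)) (fst (Q y')) \<le> \<rho> (Suc (2 * n + 1))"
        if y: "y \<in> M2" "y' \<in> M2" "d2 y y' \<le> r" for y y'
      proof (rule R21)
        have "d2 (snd (Q y)) (snd (Q y')) \<le> d2 (snd (Q y)) y + (d2 y y' + d2 y' (snd (Q y')))"
          using M2.triangle[of "snd (Q y)" y "snd (Q y')"] M2.triangle[of y y' "snd (Q y')"] y QM by fastforce
        also have "\<dots> \<le> \<rho> 1 + (r + \<rho> 1)"
          using dQ y by (intro add_mono) (auto simp: M2.commute)
        finally show "d2 (snd (Q y)) (snd (Q y')) \<le> \<rho> (2 * n + 1)"
          using n \<rho>_unbounded[of 1 n] \<rho>(1)[of 1] by simp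
      qed (use Q y in auto)
      then show "\<exists>s. \<forall>y\<in>M2. \<forall>y'\<in>M2. d2 y y' \<le> r \<longrightarrow> d1 (fst (Q y)) (fst (Q y')) \<le> s" by blast
    qed
  qed
qed

end

section \<open>Functoriality of the Higson corona\<close>

context Metric_space
begin

abbreviation higson_product :: "(('a \<Rightarrow> complex) \<Rightarrow> complex) topology" where
  "higson_product \<equiv> product_topology (\<lambda>_. euclidean) higson_functions"

text \<open>The supremum in the definition of a Higson function can be replaced by a pointwise bound, at the
price of halving \<open>\<epsilon>\<close> in one direction.\<close>

lemma higson_functions_iff:
  "f \<in> higson_functions \<longleftrightarrow>
     f \<in> extensional M \<and> continuous_map mtopology euclidean f \<and> bounded (f ` M) \<and>
     (\<forall>r>0. \<forall>\<epsilon>>0. \<exists>B. mbounded B \<and> (\<forall>x\<in>M - B. \<forall>y\<in>M. d x y \<le> r \<longrightarrow> norm (f x - f y) < \<epsilon>))"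
    (is "_ \<longleftrightarrow> ?basic \<and> ?cont \<and> ?bdd \<and> ?osc")
proof -
  have "(\<forall>r>0. \<forall>\<epsilon>>0. \<exists>B. mbounded B \<and>
           (\<forall>x \<in> M - B. (SUP y \<in> {y \<in> M. d x y \<le> r}. norm (f x - f y)) < \<epsilon>)) \<longleftrightarrow> ?osc"
    if bdd: ?bdd
  proof (intro iffI allI impI)
    obtain C where C: "\<And>x. x \<in> M \<Longrightarrow> norm (f x) \<le> C" using bdd by (auto simp: bounded_iff)
    have above: "bdd_above ((\<lambda>y. norm (f x - f y)) ` {y \<in> M. d x y \<le> r})" if "x \<in> M" for x r
    proof (rule bdd_aboveI2)
      fix y assume "y \<in> {y \<in> M. d x y \<le> r}"
      then show "norm (f x - f y) \<le> C + C"
        using C[of x] C[of y] that norm_triangle_ineq4[of "f x" "f y"] by simp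
    qed
    fix r \<epsilon> :: real assume "0 < r" "0 < \<epsilon>"
    {
      assume "\<forall>r>0. \<forall>\<epsilon>>0. \<exists>B. mbounded B \<and>
           (\<forall>x \<in> M - B. (SUP y \<in> {y \<in> M. d x y \<le> r}. norm (f x - f y)) < \<epsilon>)"
      then obtain B where B: "mbounded B"
          "\<And>x. x \<in> M - B \<Longrightarrow> (SUP y \<in> {y \<in> M. d x y \<le> r}. norm (f x - f y)) < \<epsilon>"
        using \<open>0 < r\<close> \<open>0 < \<epsilon>\<close> by meson
      have "norm (f x - f y) < \<epsilon>" if "x \<in> M - B" "y \<in> M" "d x y \<le> r" for x y
        using B(2)[OF that(1)] cSUP_upper[OF _ above[of x r], of y] that by fastforce
      then show "\<exists>B. mbounded B \<and> (\<forall>x\<in>M - B. \<forall>y\<in>M. d x y \<le> r \<longrightarrow> norm (f x - f y) < \<epsilon>)"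
        using B(1) by blast
    next
      assume ?osc
      then obtain B where B: "mbounded B"
          "\<And>x y. \<lbrakk>x \<in> M - B; y \<in> M; d x y \<le> r\<rbrakk> \<Longrightarrow> norm (f x - f y) < \<epsilon> / 2"
        using \<open>0 < r\<close> half_gt_zero[OF \<open>0 < \<epsilon>\<close>] by meson
      have "(SUP y \<in> {y \<in> M. d x y \<le> r}. norm (f x - f y)) < \<epsilon>" if x: "x \<in> M - B" for x
      proof -
        have "x \<in> {y \<in> M. d x y \<le> r}" using x \<open>0 < r\<close> by simp
        then have "(SUP y \<in> {y \<in> M. d x y \<le> r}. norm (f x - f y)) \<le> \<epsilon> / 2"
          using B(2)[OF x] by (intro cSUP_least) (auto simp: less_imp_le)
        then show ?thesis using \<open>0 < \<epsilon>\<close> by linarith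
      qed
      then show "\<exists>B. mbounded B \<and>
           (\<forall>x \<in> M - B. (SUP y \<in> {y \<in> M. d x y \<le> r}. norm (f x - f y)) < \<epsilon>)"
        using B(1) by blast
    }
  qed
  then show ?thesis unfolding higson_functions_def by blast
qed

lemma higson_corona_eq:
  "higson_corona = subtopology higson_product (higson_product closure_of (higson_eval ` M) - higson_eval ` M)"
  unfolding higson_corona_def topspace_higson_compactification
  by (simp add: higson_compactification_def subtopology_subtopology Int_absorb1 Diff_subset)

lemma topspace_higson_corona:
  "topspace higson_corona = higson_product closure_of (higson_eval ` M) - higson_eval ` M"
proof -
  have "higson_product closure_of (higson_eval ` M) - higson_eval ` M \<subseteq> topspace higson_product"
    using closure_of_subset_topspace[of higson_product] by blast
  then show ?thesis unfolding higson_corona_eq topspace_subtopology by blast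
qed

lemma continuous_map_higson_eval: "continuous_map mtopology higson_product higson_eval"
  unfolding higson_eval_def continuous_map_componentwise by (auto simp: higson_functions_def)

text \<open>A bounded set lies in a compact ball, whose image is compact and therefore closed in the Hausdorff
product; since it consists of evaluations, removing it from the space loses no point of the corona.\<close>

lemma corona_in_closure_outside_bounded:
  assumes "mproper" "\<phi> \<in> topspace higson_corona" "mbounded B"
  shows "\<phi> \<in> higson_product closure_of (higson_eval ` (M - B))"
proof -
  obtain a r where B: "B \<subseteq> mcball a r" using assms(3) by (auto simp: mbounded_def)
  have "compactin mtopology (mcball a r)"
  proof (cases "a \<in> M \<and> 0 \<le> r")
    case True
    then show ?thesis using assms(1) by (simp add: mproper_def)
  next
    case False
    then have "mcball a r = {}" by (auto simp: mcball_eq_empty)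
    then show ?thesis by simp
  qed
  then have "compactin higson_product (higson_eval ` mcball a r)"
    using image_compactin continuous_map_higson_eval by blast
  then have "closedin higson_product (higson_eval ` mcball a r)"
    by (intro compactin_imp_closedin) (simp_all add: Hausdorff_space_product_topology)
  then have cl: "higson_product closure_of (higson_eval ` mcball a r) = higson_eval ` mcball a r"
    by (simp add: closure_of_closedin)
  have "higson_eval ` M = higson_eval ` mcball a r \<union> higson_eval ` (M - mcball a r)"
    by (auto simp: image_iff)
  then have "\<phi> \<in> higson_eval ` mcball a r \<union> higson_product closure_of (higson_eval ` (M - mcball a r))"
    using assms(2) cl by (metis DiffD1 closure_of_Un topspace_higson_corona)
  moreover have "\<phi> \<notin> higson_eval ` mcball a r"
    using assms(2) by (auto simp: topspace_higson_corona)
  moreover have "higson_eval ` (M - mcball a r) \<subseteq> higson_eval ` (M - B)" using B by blast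
  ultimately show ?thesis using closure_of_mono by blast
qed

text \<open>Closed conditions that hold near infinity hold on the corona. It is applied to \<open>F \<psi> = \<psi> h\<close> and to
\<open>F \<psi> = \<psi> h - \<psi> k\<close>.\<close>

lemma corona_value_in_closed:
  assumes "mproper" "\<phi> \<in> topspace higson_corona" "mbounded B"
    and "continuous_map higson_product euclidean F" "closed C"
    and "\<And>x. x \<in> M - B \<Longrightarrow> F (higson_eval x) \<in> C"
  shows "F \<phi> \<in> C"
proof -
  let ?T = "{\<psi> \<in> topspace higson_product. F \<psi> \<in> C}"
  have "closedin higson_product ?T"
    using closedin_continuous_map_preimage[OF assms(4), of C] assms(5) by simp
  moreover have "higson_eval ` (M - B) \<subseteq> ?T"
    using assms(6) higson_eval_in_product by blast
  ultimately show ?thesis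
    using closure_of_minimal corona_in_closure_outside_bounded[OF assms(1-3)] by blast
qed

lemma corona_eq_if_vanishing_difference:
  assumes "mproper" "\<phi> \<in> topspace higson_corona"
    and h: "h \<in> higson_functions" and k: "k \<in> higson_functions"
    and "\<And>\<epsilon>. 0 < \<epsilon> \<Longrightarrow> \<exists>B. mbounded B \<and> (\<forall>x\<in>M - B. norm (h x - k x) \<le> \<epsilon>)"
  shows "\<phi> h = \<phi> k"
proof -
  have cont: "continuous_map higson_product euclidean (\<lambda>\<psi>. \<psi> h - \<psi> k)"
    using h k by (intro continuous_map_diff continuous_map_product_projection)
  have "norm (\<phi> h - \<phi> k) \<le> 0 + \<epsilon>" if \<epsilon>: "0 < \<epsilon>" for \<epsilon>
  proof -
    obtain B where B: "mbounded B" "\<And>x. x \<in> M - B \<Longrightarrow> norm (h x - k x) \<le> \<epsilon>"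
      using assms(5)[OF \<epsilon>] by blast
    have "\<phi> h - \<phi> k \<in> cball 0 \<epsilon>"
      using B(2) h k
      by (intro corona_value_in_closed[OF assms(1,2) B(1) cont]) (auto simp: higson_eval_def)
    then show ?thesis by simp
  qed
  then have "norm (\<phi> h - \<phi> k) \<le> 0" by (rule field_le_epsilon)
  then show ?thesis by simp
qed

end

context Metric_space12
begin

text \<open>Continuity is demanded besides the two conditions on large distances because Higson functions are
continuous and pulling them back has to preserve this.\<close>

definition continuous_coarse_map :: "('a \<Rightarrow> 'b) \<Rightarrow> bool" where
  "continuous_coarse_map f \<longleftrightarrow>
     continuous_map M1.mtopology M2.mtopology f \<and>
     (\<forall>r. \<exists>s. \<forall>x\<in>M1. \<forall>x'\<in>M1. d1 x x' \<le> r \<longrightarrow> d2 (f x) (f x') \<le> s) \<and>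
     (\<forall>B. M2.mbounded B \<longrightarrow> M1.mbounded {x \<in> M1. f x \<in> B})"

definition higson_pullback :: "('a \<Rightarrow> 'b) \<Rightarrow> ('b \<Rightarrow> complex) \<Rightarrow> 'a \<Rightarrow> complex" where
  "higson_pullback f h = (\<lambda>x\<in>M1. h (f x))"

text \<open>This is defined on the whole product and not only on the corona, so that its continuity can be read
off from the coordinates; it extends \<open>f\<close> under the evaluation maps.\<close>

definition corona_map :: "('a \<Rightarrow> 'b) \<Rightarrow> (('a \<Rightarrow> complex) \<Rightarrow> complex) \<Rightarrow> ('b \<Rightarrow> complex) \<Rightarrow> complex" where
  "corona_map f \<phi> = (\<lambda>h\<in>M2.higson_functions. \<phi> (higson_pullback f h))"

lemma continuous_coarse_map_in:
  "\<lbrakk>continuous_coarse_map f; x \<in> M1\<rbrakk> \<Longrightarrow> f x \<in> M2"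
  using continuous_map_image_subset_topspace unfolding continuous_coarse_map_def by fastforce

lemma higson_pullback_in_higson_functions:
  assumes f: "continuous_coarse_map f" and h: "h \<in> M2.higson_functions"
  shows "higson_pullback f h \<in> M1.higson_functions"
proof -
  note fM = continuous_coarse_map_in[OF f]
  have "continuous_map M1.mtopology euclidean (h \<circ> f)"
    using f h by (auto simp: continuous_coarse_map_def M2.higson_functions_def intro: continuous_map_compose)
  then have "continuous_map M1.mtopology euclidean (higson_pullback f h)"
    by (rule continuous_map_eq) (simp add: higson_pullback_def)
  moreover have "bounded (higson_pullback f h ` M1)"
  proof (rule bounded_subset)
    show "bounded (h ` M2)" using h by (simp add: M2.higson_functions_def)
    show "higson_pullback f h ` M1 \<subseteq> h ` M2" using fM by (auto simp: higson_pullback_def)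
  qed
  moreover have "\<exists>B. M1.mbounded B \<and> (\<forall>x\<in>M1 - B. \<forall>y\<in>M1. d1 x y \<le> r \<longrightarrow>
      norm (higson_pullback f h x - higson_pullback f h y) < \<epsilon>)" if "0 < \<epsilon>" for r \<epsilon> :: real
  proof -
    obtain s where s: "\<And>x x'. \<lbrakk>x \<in> M1; x' \<in> M1; d1 x x' \<le> r\<rbrakk> \<Longrightarrow> d2 (f x) (f x') \<le> s"
      using f unfolding continuous_coarse_map_def by meson
    have "0 < max s 1" by simp
    then obtain B where B: "M2.mbounded B"
        "\<And>x y. \<lbrakk>x \<in> M2 - B; y \<in> M2; d2 x y \<le> max s 1\<rbrakk> \<Longrightarrow> norm (h x - h y) < \<epsilon>"
      using h \<open>0 < \<epsilon>\<close> unfolding M2.higson_functions_iff by meson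
    have "M1.mbounded {x \<in> M1. f x \<in> B}" using f B(1) by (simp add: continuous_coarse_map_def)
    moreover have "norm (higson_pullback f h x - higson_pullback f h y) < \<epsilon>"
      if "x \<in> M1 - {x \<in> M1. f x \<in> B}" "y \<in> M1" "d1 x y \<le> r" for x y
      using B(2)[of "f x" "f y"] s[of x y] fM that by (simp add: higson_pullback_def max.coboundedI1)
    ultimately show ?thesis by blast
  qed
  ultimately show ?thesis
    unfolding M1.higson_functions_iff by (simp add: higson_pullback_def)
qed

lemma continuous_map_corona_map:
  assumes "continuous_coarse_map f"
  shows "continuous_map M1.higson_product M2.higson_product (corona_map f)"
  unfolding corona_map_def continuous_map_componentwise
  using higson_pullback_in_higson_functions[OF assms]
  by (auto intro: continuous_map_product_projection)

lemma corona_map_higson_eval: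
  assumes "continuous_coarse_map f" "x \<in> M1"
  shows "corona_map f (M1.higson_eval x) = M2.higson_eval (f x)"
  using assms higson_pullback_in_higson_functions[OF assms(1)]
  by (auto simp: corona_map_def M1.higson_eval_def M2.higson_eval_def higson_pullback_def)

text \<open>Properness of \<open>f\<close> keeps the corona away from evaluations: a Higson function supported in a ball around
\<open>y\<close> that takes the value 1 at \<open>y\<close> pulls back to a function of bounded support, on which every point of
the corona vanishes.\<close>

lemma corona_map_in_corona:
  assumes f: "continuous_coarse_map f" and proper: "M1.mproper" "M2.mproper"
    and \<phi>: "\<phi> \<in> topspace M1.higson_corona"
  shows "corona_map f \<phi> \<in> topspace M2.higson_corona"
proof -
  have "corona_map f ` (M1.higson_eval ` M1) \<subseteq> M2.higson_eval ` M2"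
    using corona_map_higson_eval[OF f] continuous_coarse_map_in[OF f] by auto
  moreover have "\<phi> \<in> M1.higson_product closure_of (M1.higson_eval ` M1)"
    using \<phi> by (simp add: M1.topspace_higson_corona)
  ultimately have "corona_map f \<phi> \<in> M2.higson_product closure_of (M2.higson_eval ` M2)"
    using continuous_map_image_closure_subset[OF continuous_map_corona_map[OF f]] closure_of_mono
    by blast
  moreover have "corona_map f \<phi> \<noteq> M2.higson_eval y" if y: "y \<in> M2" for y
  proof
    assume eq: "corona_map f \<phi> = M2.higson_eval y"
    obtain h where h: "h \<in> M2.higson_functions" "h y = 1"
        "\<And>z. z \<in> M2 - M2.mball y 1 \<Longrightarrow> h z = 0"
      using M2.higson_bump[OF proper(2) M2.openin_mball[of y 1], of y] y by auto
    note ph = higson_pullback_in_higson_functions[OF f h(1)]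
    define B where "B = {x \<in> M1. f x \<in> M2.mball y 1}"
    have B: "M1.mbounded B"
      using f M2.mbounded_mball unfolding continuous_coarse_map_def B_def by blast
    have cont: "continuous_map M1.higson_product euclidean (\<lambda>\<psi>. \<psi> (higson_pullback f h))"
      using ph by (rule continuous_map_product_projection)
    have "M1.higson_eval x (higson_pullback f h) \<in> {0}" if "x \<in> M1 - B" for x
      using that h(3)[of "f x"] continuous_coarse_map_in[OF f, of x] ph
      by (simp add: M1.higson_eval_def higson_pullback_def B_def)
    then have "\<phi> (higson_pullback f h) \<in> {0}"
      by (rule M1.corona_value_in_closed[OF proper(1) \<phi> B cont closed_singleton])
    moreover have "\<phi> (higson_pullback f h) = 1"
      using fun_cong[OF eq, of h] h(1,2) by (simp add: corona_map_def M2.higson_eval_def)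
    ultimately show False by simp
  qed
  ultimately show ?thesis by (auto simp: M2.topspace_higson_corona)
qed

lemma continuous_map_corona_map_corona:
  assumes "continuous_coarse_map f" "M1.mproper" "M2.mproper"
  shows "continuous_map M1.higson_corona M2.higson_corona (corona_map f)"
proof -
  have "continuous_map M1.higson_corona M2.higson_product (corona_map f)"
    unfolding M1.higson_corona_eq
    by (rule continuous_map_from_subtopology[OF continuous_map_corona_map[OF assms(1)]])
  moreover have "corona_map f ` topspace M1.higson_corona \<subseteq>
      M2.higson_product closure_of (M2.higson_eval ` M2) - M2.higson_eval ` M2"
    using corona_map_in_corona[OF assms] by (auto simp: M2.topspace_higson_corona)
  ultimately show ?thesis
    unfolding M2.higson_corona_eq by (simp add: continuous_map_in_subtopology image_subset_iff_funcset)
qed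

text \<open>Properness of \<open>f\<close> comes from the coarse inverse: if \<open>f x\<close> stays near \<open>b\<close>, then \<open>g (f x)\<close> stays near
\<open>g b\<close>, and so does \<open>x\<close>.\<close>

lemma continuous_coarse_map_if_locally_constant:
  assumes f: "f \<in> M1 \<rightarrow> M2" and g: "g \<in> M2 \<rightarrow> M1" and "0 < \<delta>"
    and const: "\<And>x x'. \<lbrakk>x \<in> M1; x' \<in> M1; d1 x x' \<le> \<delta>\<rbrakk> \<Longrightarrow> f x = f x'"
    and born_f: "\<forall>r. \<exists>s. \<forall>x\<in>M1. \<forall>x'\<in>M1. d1 x x' \<le> r \<longrightarrow> d2 (f x) (f x') \<le> s"
    and born_g: "\<forall>r. \<exists>s. \<forall>y\<in>M2. \<forall>y'\<in>M2. d2 y y' \<le> r \<longrightarrow> d1 (g y) (g y') \<le> s"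
    and close: "\<And>x. x \<in> M1 \<Longrightarrow> d1 x (g (f x)) \<le> C"
  shows "continuous_coarse_map f"
  unfolding continuous_coarse_map_def
proof (intro conjI born_f allI impI)
  have "openin M1.mtopology {x \<in> M1. f x \<in> U}" for U
    unfolding M1.openin_mtopology
  proof (intro conjI allI impI)
    fix x assume x: "x \<in> {x \<in> M1. f x \<in> U}"
    then have "M1.mball x \<delta> \<subseteq> {x \<in> M1. f x \<in> U}"
      using const[of x] by fastforce
    then show "\<exists>r>0. M1.mball x r \<subseteq> {x \<in> M1. f x \<in> U}" using \<open>0 < \<delta>\<close> by blast
  qed auto
  then show "continuous_map M1.mtopology M2.mtopology f"
    using f by (auto simp: continuous_map_def)
next
  fix B assume "M2.mbounded B"
  then obtain b R where B: "B \<subseteq> M2.mcball b R" by (auto simp: M2.mbounded_def)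
  obtain s where s: "\<forall>y\<in>M2. \<forall>y'\<in>M2. d2 y y' \<le> R \<longrightarrow> d1 (g y) (g y') \<le> s"
    using born_g by blast
  have "{x \<in> M1. f x \<in> B} \<subseteq> M1.mcball (g b) (s + C)"
  proof
    fix x assume x: "x \<in> {x \<in> M1. f x \<in> B}"
    then have b: "b \<in> M2" "f x \<in> M2" "d2 b (f x) \<le> R" using B by auto
    then have "g b \<in> M1" "g (f x) \<in> M1" using g by auto
    moreover have "d1 (g b) (g (f x)) \<le> s" using s b by blast
    moreover have "d1 (g b) x \<le> d1 (g b) (g (f x)) + d1 (g (f x)) x"
      using M1.triangle x calculation by auto
    ultimately show "x \<in> M1.mcball (g b) (s + C)"
      using close[of x] M1.commute[of x "g (f x)"] x by auto
  qed
  then show "M1.mbounded {x \<in> M1. f x \<in> B}" unfolding M1.mbounded_def by blast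
qed

end

context Metric_space12
begin

interpretation swap: Metric_space12 M2 d2 M1 d1
  by unfold_locales

text \<open>As \<open>g \<circ> f\<close> moves points by at most \<open>C\<close>, the functions \<open>h\<close> and \<open>h \<circ> g \<circ> f\<close> differ by a function that tends
to 0 at infinity.\<close>

lemma corona_map_retraction:
  assumes f: "continuous_coarse_map f" and g: "swap.continuous_coarse_map g"
    and close: "\<And>x. x \<in> M1 \<Longrightarrow> d1 x (g (f x)) \<le> C"
    and proper: "M1.mproper" and \<phi>: "\<phi> \<in> topspace M1.higson_corona"
  shows "swap.corona_map g (corona_map f \<phi>) = \<phi>"
proof (rule extensionalityI)
  show "swap.corona_map g (corona_map f \<phi>) \<in> extensional M1.higson_functions"
    by (simp add: swap.corona_map_def)
  have "\<phi> \<in> topspace M1.higson_product"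
    using \<phi> closure_of_subset_topspace[of M1.higson_product] by (auto simp: M1.topspace_higson_corona)
  then show "\<phi> \<in> extensional M1.higson_functions"
    by (simp add: PiE_def)
  fix h assume h: "h \<in> M1.higson_functions"
  note gh = swap.higson_pullback_in_higson_functions[OF g h]
  note fgh = higson_pullback_in_higson_functions[OF f gh]
  have "\<exists>B. M1.mbounded B \<and> (\<forall>x\<in>M1 - B. norm (h x - higson_pullback f (swap.higson_pullback g h) x) \<le> \<epsilon>)"
    if "0 < \<epsilon>" for \<epsilon>
  proof -
    have "0 < max C 1" by simp
    then obtain B where B: "M1.mbounded B"
        "\<And>x y. \<lbrakk>x \<in> M1 - B; y \<in> M1; d1 x y \<le> max C 1\<rbrakk> \<Longrightarrow> norm (h x - h y) < \<epsilon>"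
      using h \<open>0 < \<epsilon>\<close> unfolding M1.higson_functions_iff by meson
    have "norm (h x - higson_pullback f (swap.higson_pullback g h) x) \<le> \<epsilon>" if x: "x \<in> M1 - B" for x
    proof -
      have "f x \<in> M2" "g (f x) \<in> M1"
        using x continuous_coarse_map_in[OF f] swap.continuous_coarse_map_in[OF g] by auto
      then show ?thesis
        using B(2)[OF x, of "g (f x)"] close[of x] x
        by (simp add: higson_pullback_def swap.higson_pullback_def max.coboundedI1 less_imp_le)
    qed
    then show ?thesis using B(1) by blast
  qed
  then have "\<phi> h = \<phi> (higson_pullback f (swap.higson_pullback g h))"
    by (intro M1.corona_eq_if_vanishing_difference[OF proper \<phi> h fgh])
  then show "swap.corona_map g (corona_map f \<phi>) h = \<phi> h"
    using h gh by (simp add: swap.corona_map_def corona_map_def)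
qed

theorem higson_coronas_homeomorphic_if_coarsely_inverse:
  assumes f: "continuous_coarse_map f" and g: "swap.continuous_coarse_map g"
    and "\<And>x. x \<in> M1 \<Longrightarrow> d1 x (g (f x)) \<le> C" "\<And>y. y \<in> M2 \<Longrightarrow> d2 y (f (g y)) \<le> C"
    and proper: "M1.mproper" "M2.mproper"
  shows "M1.higson_corona homeomorphic_space M2.higson_corona"
proof -
  have "homeomorphic_maps M1.higson_corona M2.higson_corona (corona_map f) (swap.corona_map g)"
    unfolding homeomorphic_maps_def
    using continuous_map_corona_map_corona[OF f proper]
      swap.continuous_map_corona_map_corona[OF g proper(2,1)]
      corona_map_retraction[OF f g assms(3) proper(1)]
      Metric_space12.corona_map_retraction[OF swap.Metric_space12_axioms g f assms(4) proper(2)] by blast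
  then show ?thesis unfolding homeomorphic_space_def by blast
qed

end

section \<open>Coronas of homogeneous proper ultrametric spaces\<close>

theorem corollary1:
  fixes X :: "'a set" and dX :: "'a \<Rightarrow> 'a \<Rightarrow> real"
    and Y :: "'b set" and dY :: "'b \<Rightarrow> 'b \<Rightarrow> real"
  assumes "Metric_space X dX" and "Metric_space Y dY"
    and "Metric_space.mhomogeneous X dX" and "Metric_space.mhomogeneous Y dY"
    and "Metric_space.mproper X dX" and "Metric_space.mproper Y dY"
    and "Metric_space.multrametric X dX" and "Metric_space.multrametric Y dY"
  shows "Metric_space.higson_corona X dX homeomorphic_space Metric_space.higson_corona Y dY"
proof -
  interpret Metric_space12 X dX Y dY
    using assms(1,2) by (simp add: Metric_space12_def)
  interpret swap: Metric_space12 Y dY X dX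
    using assms(1,2) by (simp add: Metric_space12_def)
  show ?thesis
  proof (rule homogeneous_ultrametric_coarse_equivalence[OF assms(3-8)])
    fix f g \<delta> C assume fg: "f \<in> X \<rightarrow> Y" "g \<in> Y \<rightarrow> X" "0 < \<delta>"
    "\<And>x x'. \<lbrakk>x \<in> X; x' \<in> X; dX x x' \<le> \<delta>\<rbrakk> \<Longrightarrow> f x = f x'"
    "\<And>y y'. \<lbrakk>y \<in> Y; y' \<in> Y; dY y y' \<le> \<delta>\<rbrakk> \<Longrightarrow> g y = g y'"
    "\<forall>r. \<exists>s. \<forall>x\<in>X. \<forall>x'\<in>X. dX x x' \<le> r \<longrightarrow> dY (f x) (f x') \<le> s"
    "\<forall>r. \<exists>s. \<forall>y\<in>Y. \<forall>y'\<in>Y. dY y y' \<le> r \<longrightarrow> dX (g y) (g y') \<le> s"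
    "\<And>x. x \<in> X \<Longrightarrow> dX x (g (f x)) \<le> C" "\<And>y. y \<in> Y \<Longrightarrow> dY y (f (g y)) \<le> C"
  have "continuous_coarse_map f"
    by (rule continuous_coarse_map_if_locally_constant[OF fg(1-4,6-8)])
  moreover have "swap.continuous_coarse_map g"
    by (rule swap.continuous_coarse_map_if_locally_constant[OF fg(2,1,3,5,7,6,9)])
  ultimately show ?thesis
    by (rule higson_coronas_homeomorphic_if_coarsely_inverse[OF _ _ fg(8,9) assms(5,6)])
  qed
qed

end
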